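(* Let $f\in\mathbb{R}[x,y]$ be a homogeneous polynomial of degree $n\ge 2$ such that $f$ has no repeated real linear factors and its Hessian polynomial $|\operatorname{Hess} f|$ has no repeated real linear factors. Then a point of $\mathbb{S}^2$ is an umbilic point at infinity of $f$ if and only if it is a flat point of $\Phi$ lying on the equator $\mathbb{S}^2\cap\{\omega=0\}$.
   Context: Notation. $|\operatorname{Hess} f|=f_{xx}f_{yy}-f_{xy}^2$. The form $\Phi$. Regard $f=f(u,v)$ as a polynomial in $u,v$ and set $A=f_{uv}f_u^2-f_{uu}f_uf_v+\omega^{2(n-1)}f_{uv}$, $B=f_{vv}f_u^2-f_{uu}f_v^2+\omega^{2(n-1)}(f_{vv}-f_{uu})$, $C=f_{vv}f_uf_v-f_{uv}f_v^2-\omega^{2(n-1)}f_{uv}$. On $\mathbb{S}^2=\{(u,v,\omega): u^2+v^2+\omega^2=1\}$ consider the analytic quadratic differential form $$\Phi=\omega A\,du^2+\omega B\,du\,dv+\omega C\,dv^2-(2uA+vB)\,du\,d\omega-(uB+2vC)\,dv\,d\omega+(n-1)\omega^{2n-3}(uf_v-vf_u)\,d\omega^2 .$$ It extends to $\mathbb{S}^2$ (via central projection, up to a power of $\omega$) the quadratic form on $\mathbb{R}^2$ defining the principal directions of the graph of $f$. A flat point of $\Phi$ is a point of $\mathbb{S}^2$ at which all coefficients of $\Phi$ vanish. An umbilic point at infinity (of $f$) is a point of the equator $\mathbb{S}^2\cap\{\omega=0\}$ that is an isolated flat point of $\Phi$ (isolated among the flat points of $\Phi$ in $\mathbb{S}^2$).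 *)

theory Defs
  imports "HOL-Analysis.Analysis" "HOL-Computational_Algebra.Polynomial"
begin

section \<open>Real polynomials in two variables\<close>

text \<open>
  The ring \<open>\<real>[x,y]\<close> is represented as \<open>\<real>[x][y]\<close>, i.e. as the type \<open>real poly poly\<close>:
  the outer variable is \<open>y\<close>, and \<open>coeff (coeff f j) i\<close> is the coefficient of \<open>x^i * y^j\<close>.
\<close>

definition eval2 :: "real poly poly \<Rightarrow> real \<Rightarrow> real \<Rightarrow> real" where
  "eval2 f x y = poly (poly f [:y:]) x"

definition pd_x :: "real poly poly \<Rightarrow> real poly poly" where
  "pd_x f = map_poly pderiv f"

definition pd_y :: "real poly poly \<Rightarrow> real poly poly" where
  "pd_y f = pderiv f"

definition homogeneous :: "nat \<Rightarrow> real poly poly \<Rightarrow> bool" where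
  "homogeneous n f \<longleftrightarrow> f \<noteq> 0 \<and> (\<forall>i j. coeff (coeff f j) i \<noteq> 0 \<longrightarrow> i + j = n)"

definition hess :: "real poly poly \<Rightarrow> real poly poly" where
  "hess f = pd_x (pd_x f) * pd_y (pd_y f) - (pd_y (pd_x f))\<^sup>2"

text \<open>The linear form \<open>a x + b y\<close>.\<close>

definition linear_form :: "real \<Rightarrow> real \<Rightarrow> real poly poly" where
  "linear_form a b = [: [:0, a:], [:b:] :]"

text \<open>
  This is applied to homogeneous polynomials (or to zero, which does not qualify) only. Factors of a
  nonzero homogeneous polynomial are homogeneous, so the linear factors are linear forms.
\<close>

definition no_repeated_linear_factor :: "real poly poly \<Rightarrow> bool" where
  "no_repeated_linear_factor g \<longleftrightarrow>
     \<not> (\<exists>a b. (a, b) \<noteq> (0, 0) \<and> (linear_form a b)\<^sup>2 dvd g)"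

lemma eval2_0 [simp]: "eval2 0 x y = 0"
  by (simp add: eval2_def)

lemma eval2_pCons [simp]: "eval2 (pCons p f) x y = poly p x + y * eval2 f x y"
  by (simp add: eval2_def)

lemma eval2_add [simp]: "eval2 (f + g) x y = eval2 f x y + eval2 g x y"
  by (simp add: eval2_def)

lemma pd_x_pCons [simp]: "pd_x (pCons p f) = pCons (pderiv p) (pd_x f)"
  by (simp add: pd_x_def map_poly_pCons)

lemma pd_x_0 [simp]: "pd_x 0 = 0"
  by (simp add: pd_x_def)

lemma has_derivative_pd_x:
  "((\<lambda>t. eval2 f t y) has_real_derivative eval2 (pd_x f) x y) (at x)"
  by (induction f) (auto intro!: derivative_eq_intros)

lemma has_derivative_pd_y:
  "((\<lambda>t. eval2 f x t) has_real_derivative eval2 (pd_y f) x y) (at y)"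
  by (induction f) (auto simp: pd_y_def pderiv_pCons intro!: derivative_eq_intros)


section \<open>The quadratic differential form on the sphere\<close>

text \<open>Points and tangent vectors of \<open>\<real>\<^sup>3\<close> are triples \<open>(u, v, w)\<close>, with \<open>w\<close> for \<open>\<omega>\<close>.\<close>

definition S2 :: "(real \<times> real \<times> real) set" where
  "S2 = {(u, v, w). u\<^sup>2 + v\<^sup>2 + w\<^sup>2 = 1}"

definition equator :: "(real \<times> real \<times> real) set" where
  "equator = S2 \<inter> {(u, v, w). w = 0}"

context
  fixes n :: nat and f :: "real poly poly"
begin

definition Phi_A :: "real \<times> real \<times> real \<Rightarrow> real" where
  "Phi_A = (\<lambda>(u, v, w).
     let fu = eval2 (pd_x f) u v; fv = eval2 (pd_y f) u v;
         fuu = eval2 (pd_x (pd_x f)) u v; fuv = eval2 (pd_y (pd_x f)) u v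
     in fuv * fu\<^sup>2 - fuu * fu * fv + w ^ (2 * (n - 1)) * fuv)"

definition Phi_B :: "real \<times> real \<times> real \<Rightarrow> real" where
  "Phi_B = (\<lambda>(u, v, w).
     let fu = eval2 (pd_x f) u v; fv = eval2 (pd_y f) u v;
         fuu = eval2 (pd_x (pd_x f)) u v; fvv = eval2 (pd_y (pd_y f)) u v
     in fvv * fu\<^sup>2 - fuu * fv\<^sup>2 + w ^ (2 * (n - 1)) * (fvv - fuu))"

definition Phi_C :: "real \<times> real \<times> real \<Rightarrow> real" where
  "Phi_C = (\<lambda>(u, v, w).
     let fu = eval2 (pd_x f) u v; fv = eval2 (pd_y f) u v;
         fuv = eval2 (pd_y (pd_x f)) u v; fvv = eval2 (pd_y (pd_y f)) u v
     in fvv * fu * fv - fuv * fv\<^sup>2 - w ^ (2 * (n - 1)) * fuv)"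

text \<open>
  The coefficients of \<open>du\<^sup>2\<close>, \<open>du dv\<close>, \<open>dv\<^sup>2\<close>, \<open>du dw\<close>, \<open>dv dw\<close> and \<open>dw\<^sup>2\<close>. In the last one
  the exponent is only meaningful for \<open>n \<ge> 2\<close>.
\<close>

definition Phi_uu :: "real \<times> real \<times> real \<Rightarrow> real" where
  "Phi_uu = (\<lambda>(u, v, w). w * Phi_A (u, v, w))"

definition Phi_uv :: "real \<times> real \<times> real \<Rightarrow> real" where
  "Phi_uv = (\<lambda>(u, v, w). w * Phi_B (u, v, w))"

definition Phi_vv :: "real \<times> real \<times> real \<Rightarrow> real" where
  "Phi_vv = (\<lambda>(u, v, w). w * Phi_C (u, v, w))"

definition Phi_uw :: "real \<times> real \<times> real \<Rightarrow> real" where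
  "Phi_uw = (\<lambda>(u, v, w). - (2 * u * Phi_A (u, v, w) + v * Phi_B (u, v, w)))"

definition Phi_vw :: "real \<times> real \<times> real \<Rightarrow> real" where
  "Phi_vw = (\<lambda>(u, v, w). - (u * Phi_B (u, v, w) + 2 * v * Phi_C (u, v, w)))"

definition Phi_ww :: "real \<times> real \<times> real \<Rightarrow> real" where
  "Phi_ww = (\<lambda>(u, v, w).
     real (n - 1) * w ^ (2 * n - 3) * (u * eval2 (pd_y f) u v - v * eval2 (pd_x f) u v))"

definition Phi :: "real \<times> real \<times> real \<Rightarrow> real \<times> real \<times> real \<Rightarrow> real" where
  "Phi p = (\<lambda>(du, dv, dw).
     Phi_uu p * du\<^sup>2 + Phi_uv p * du * dv + Phi_vv p * dv\<^sup>2
     + Phi_uw p * du * dw + Phi_vw p * dv * dw + Phi_ww p * dw\<^sup>2)"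

definition flat_point :: "real \<times> real \<times> real \<Rightarrow> bool" where
  "flat_point p \<longleftrightarrow> p \<in> S2 \<and>
     Phi_uu p = 0 \<and> Phi_uv p = 0 \<and> Phi_vv p = 0 \<and>
     Phi_uw p = 0 \<and> Phi_vw p = 0 \<and> Phi_ww p = 0"

definition umbilic_at_infinity :: "real \<times> real \<times> real \<Rightarrow> bool" where
  "umbilic_at_infinity p \<longleftrightarrow> p \<in> equator \<and> p isolated_in {q. flat_point q}"

lemma flat_point_iff_Phi: "flat_point p \<longleftrightarrow> p \<in> S2 \<and> (\<forall>d. Phi p d = 0)"
proof
  assume "p \<in> S2 \<and> (\<forall>d. Phi p d = 0)"
  then have p: "p \<in> S2" and z: "Phi p d = 0" for d
    by blast+
  show "flat_point p"
    using p z[of "(1, 0, 0)"] z[of "(0, 1, 0)"] z[of "(0, 0, 1)"]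
      z[of "(1, 1, 0)"] z[of "(1, 0, 1)"] z[of "(0, 1, 1)"]
    by (simp add: Phi_def flat_point_def)
qed (auto simp: Phi_def flat_point_def)

end

end

theory Submission
  imports Defs
begin

text \<open>
  An umbilic point at infinity is by definition a flat point, so the content is that every flat
  point \<open>p = (a, b, 0)\<close> of \<open>\<Phi>\<close> on the equator is isolated. Write \<open>H\<close> for the Hessian of \<open>f\<close> and
  \<open>G = u f\<^sub>v - v f\<^sub>u\<close> for the angular derivative of \<open>f\<close>. The absence of repeated linear factors is
  used for \<open>f\<close> through the fact that its gradient vanishes at the origin only
  (\<open>repeated_factor_if_singular\<close>), and for the Hessian through \<open>H \<noteq> 0\<close>.

  On the equator, Euler's relations turn the coefficients of \<open>du d\<omega>\<close> and \<open>dv d\<omega>\<close> into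
  multiples of \<open>v f H\<close> and \<open>u f H\<close>, so flat points there are zeros of the nonzero form \<open>f H\<close>
  (\<open>flat_on_equator\<close>). A flat point \<open>(u, v, \<omega>)\<close> with \<open>\<omega> \<noteq> 0\<close> and \<open>(u, v) \<noteq> (0, 0)\<close> satisfies
  \<open>G u v = 0\<close> because of the coefficient of \<open>d\<omega>\<^sup>2\<close>, but \<open>H u v \<noteq> 0\<close>: otherwise the vanishing of
  \<open>A\<close> and \<open>B\<close> makes all second derivatives zero there, and with them the gradient
  (\<open>flat_off_equator\<close>).

  The zeros of a nonzero form near \<open>(a, b)\<close> lie on the ray through \<open>(a, b)\<close>
  (\<open>zeros_near_direction\<close>). For \<open>f H\<close> this says that \<open>p\<close> is the only flat point near \<open>p\<close> on the
  equator. For \<open>G\<close>, which is a nonzero polynomial as soon as a flat point \<open>p\<close> exists on the equator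
  (\<open>angular_derivative_nonzero\<close>), it says that a nearby flat point \<open>(u, v, \<omega>)\<close> off the equator
  would have \<open>(u, v)\<close> on that ray. Then \<open>G a b = 0\<close>, which forces \<open>f a b \<noteq> 0\<close>, hence \<open>H a b = 0\<close>
  and by homogeneity \<open>H u v = 0\<close>, contrary to what holds at flat points off the equator.
\<close>

section \<open>Evaluation and homogeneity\<close>

lemma eval2_diff: "eval2 (f - g) x y = eval2 f x y - eval2 g x y"
  by (simp add: eval2_def)

lemma eval2_mult: "eval2 (f * g) x y = eval2 f x y * eval2 g x y"
  by (simp add: eval2_def)

lemma eval2_smult: "eval2 (smult p f) x y = poly p x * eval2 f x y"
  by (simp add: eval2_def)

lemma eval2_linear_form: "eval2 (linear_form c d) x y = c * x + d * y"
  by (simp add: linear_form_def)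

lemma eval2_hess:
  "eval2 (hess f) x y =
     eval2 (pd_x (pd_x f)) x y * eval2 (pd_y (pd_y f)) x y - (eval2 (pd_y (pd_x f)) x y)\<^sup>2"
  by (simp add: hess_def eval2_diff eval2_mult power2_eq_square)

lemma eval2_double_sum:
  "eval2 f x y = (\<Sum>j\<le>degree f. \<Sum>i\<le>degree (coeff f j). coeff (coeff f j) i * x ^ i * y ^ j)"
proof -
  have "eval2 f x y = (\<Sum>j\<le>degree f. poly (coeff f j) x * y ^ j)"
    by (simp add: eval2_def poly_altdef[of f] poly_sum)
  then show ?thesis
    by (simp add: poly_altdef sum_distrib_right)
qed

lemma eval2_eq_0_imp_eq_0:
  assumes "\<And>x y. eval2 g x y = 0"
  shows "g = 0"
proof (rule ccontr)
  assume "g \<noteq> 0"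
  have "poly g [:y:] = 0" for y
    using assms by (simp add: eval2_def flip: poly_all_0_iff_0)
  then have "range (\<lambda>y::real. [:y:]) \<subseteq> {q. poly g q = 0}"
    by blast
  moreover have "infinite (range (\<lambda>y::real. [:y:]))"
    by (simp add: finite_image_iff inj_on_def infinite_UNIV_char_0)
  ultimately show False
    using poly_roots_finite[OF \<open>g \<noteq> 0\<close>] infinite_super by blast
qed

text \<open>
  Restricting to a line gives a polynomial in one variable, which is how finiteness of the set of
  roots becomes available for polynomials in two variables.
\<close>

lemma eval2_on_line:
  "\<exists>h. \<forall>t. poly h t = eval2 g (a + t * c) (b + t * d)"
proof (induction g)
  case 0
  then show ?case by (intro exI[of _ 0]) simp
next
  case (pCons p g)
  then obtain h where "\<And>t. poly h t = eval2 g (a + t * c) (b + t * d)"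
    by blast
  then show ?case
    by (intro exI[of _ "pcompose p [:a, c:] + [:b, d:] * h"]) (simp add: poly_pcompose algebra_simps)
qed

lemma coeff_pd_x: "coeff (coeff (pd_x f) j) i = real (Suc i) * coeff (coeff f j) (Suc i)"
  by (simp add: pd_x_def coeff_map_poly coeff_pderiv)

lemma coeff_pd_y: "coeff (coeff (pd_y f) j) i = real (Suc j) * coeff (coeff f (Suc j)) i"
proof -
  have "coeff (of_nat k * q) i = real k * coeff q i" for k and q :: "real poly"
    by (simp add: of_nat_poly)
  then show ?thesis
    by (simp only: pd_y_def coeff_pderiv)
qed

lemma pd_x_pd_y: "pd_x (pd_y f) = pd_y (pd_x f)"
  by (rule poly_eqI, rule poly_eqI) (simp add: coeff_pd_x coeff_pd_y)

text \<open>Unlike \<open>homogeneous\<close>, this admits zero, so that it is stable under differentiation.\<close>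

definition form :: "nat \<Rightarrow> real poly poly \<Rightarrow> bool" where
  "form k f \<longleftrightarrow> (\<forall>i j. coeff (coeff f j) i \<noteq> 0 \<longrightarrow> i + j = k)"

lemma form_pd_x: "form k f \<Longrightarrow> form (k - 1) (pd_x f)"
  by (fastforce simp: form_def coeff_pd_x)

lemma form_pd_y: "form k f \<Longrightarrow> form (k - 1) (pd_y f)"
  by (fastforce simp: form_def coeff_pd_y)

lemma form_scaling:
  assumes "form k f"
  shows "eval2 f (s * x) (s * y) = s ^ k * eval2 f x y"
proof -
  have monomial: "coeff (coeff f j) i * (s * x) ^ i * (s * y) ^ j
      = s ^ k * (coeff (coeff f j) i * x ^ i * y ^ j)" for i j
  proof (cases "coeff (coeff f j) i = 0")
    case False
    then have "k = i + j"
      using assms by (simp add: form_def)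
    then show ?thesis
      by (simp add: power_mult_distrib power_add)
  qed simp
  show ?thesis
    unfolding eval2_double_sum sum_distrib_left monomial ..
qed

text \<open>
  Both sides are evaluations of polynomials whose coefficients at \<open>x^i * y^j\<close> are \<open>i + j\<close>,
  respectively \<open>k\<close>, times that of \<open>f\<close>.
\<close>

lemma Euler_relation:
  assumes "form k f"
  shows "x * eval2 (pd_x f) x y + y * eval2 (pd_y f) x y = real k * eval2 f x y"
proof -
  have "smult [:0, 1:] (pd_x f) + pCons 0 (pd_y f) = smult [:real k:] f"
  proof (rule poly_eqI, rule poly_eqI)
    fix j i
    have "i + j = k \<or> coeff (coeff f j) i = 0"
      using assms by (auto simp: form_def)
    then have "real i * coeff (coeff f j) i + real j * coeff (coeff f j) i = real k * coeff (coeff f j) i"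
      by (auto simp: algebra_simps)
    then show "coeff (coeff (smult [:0, 1:] (pd_x f) + pCons 0 (pd_y f)) j) i
        = coeff (coeff (smult [:real k:] f) j) i"
      by (cases i; cases j) (simp_all add: coeff_pd_x coeff_pd_y del: of_nat_Suc)
  qed
  then have "eval2 (smult [:0, 1:] (pd_x f) + pCons 0 (pd_y f)) x y = eval2 (smult [:real k:] f) x y"
    by simp
  then show ?thesis
    by (simp add: eval2_smult)
qed


section \<open>Singular zeros and repeated linear factors\<close>

text \<open>
  If \<open>a \<noteq> 0\<close>, the line is the graph \<open>y = (b / a) x\<close>, and the claim is the factor theorem over
  the ring \<open>\<real>[x]\<close>. The vertical line has no such description; there, \<open>x\<close> divides
  every coefficient of \<open>g\<close> as a polynomial in \<open>y\<close>.
\<close>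

lemma linear_form_dvd_if_vanishes_on_line:
  assumes "(a, b) \<noteq> (0, 0)" and zero: "\<And>s. eval2 g (s * a) (s * b) = 0"
  shows "linear_form b (- a) dvd g"
proof (cases "a = 0")
  case True
  then have b: "b \<noteq> 0"
    using assms by simp
  have "eval2 g 0 y = poly (map_poly (\<lambda>p. poly p 0) g) y" for y
    by (induction g) (simp_all add: map_poly_pCons)
  moreover have "eval2 g 0 y = 0" for y
    using zero[of "y / b"] True b by simp
  ultimately have "map_poly (\<lambda>p. poly p 0) g = 0"
    by (simp flip: poly_all_0_iff_0)
  then have "poly (coeff g j) 0 = 0" for j
    by (metis coeff_0 coeff_map_poly poly_0)
  then have "[:0, 1:] dvd coeff g j" for j
    by (simp add: poly_eq_0_iff_dvd)
  then have "[:0, b:] dvd coeff g j" for j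
    using smult_dvd_iff[of b "[:0, 1:]"] b by simp
  then show ?thesis
    using True by (simp add: linear_form_def const_poly_dvd_iff)
next
  case False
  have "poly (poly g [:0, b / a:]) x = 0" for x
  proof -
    have "poly (poly g [:0, b / a:]) x = eval2 g x (x * (b / a))"
      by (induction g) (simp_all add: algebra_simps)
    then show ?thesis
      using zero[of "x / a"] False by simp
  qed
  then have "poly g [:0, b / a:] = 0"
    by (simp flip: poly_all_0_iff_0)
  then obtain k where k: "g = [:- [:0, b / a:], 1:] * k"
    unfolding poly_eq_0_iff_dvd ..
  have unit: "[:- a:] * [:- 1 / a:] = 1"
    using False by simp
  have "linear_form b (- a) = smult [:- a:] [:- [:0, b / a:], 1:]"
    using False by (simp add: linear_form_def)
  then have "linear_form b (- a) * smult [:- 1 / a:] k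
      = smult ([:- a:] * [:- 1 / a:]) ([:- [:0, b / a:], 1:] * k)"
    by (simp only: mult_smult_left mult_smult_right smult_smult ac_simps)
  then have "g = linear_form b (- a) * smult [:- 1 / a:] k"
    by (simp only: unit k smult_1_left)
  then show ?thesis ..
qed

text \<open>
  By homogeneity, \<open>f\<close> and its gradient vanish on the whole line through \<open>(a, b)\<close>, so \<open>f = L q\<close> with
  the linear form \<open>L\<close> of this line. On the line, the gradient of \<open>L q\<close> is \<open>q\<close> times that of \<open>L\<close>, so
  \<open>q\<close> vanishes on the line too and contains a second factor \<open>L\<close>.
\<close>

lemma repeated_factor_if_singular:
  assumes f: "form k f" and ab: "(a, b) \<noteq> (0, 0)"
    and fx: "eval2 (pd_x f) a b = 0" and fy: "eval2 (pd_y f) a b = 0" and k: "k > 0"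
  shows "(linear_form b (- a))\<^sup>2 dvd f"
proof -
  define L where "L = linear_form b (- a)"
  have fx_line: "eval2 (pd_x f) (s * a) (s * b) = 0" for s
    using form_scaling[OF form_pd_x[OF f]] fx by simp
  have fy_line: "eval2 (pd_y f) (s * a) (s * b) = 0" for s
    using form_scaling[OF form_pd_y[OF f]] fy by simp
  have "eval2 f (s * a) (s * b) = 0" for s
    using Euler_relation[OF f, of "s * a" "s * b"] fx_line fy_line k by simp
  then have "L dvd f"
    unfolding L_def using ab by (intro linear_form_dvd_if_vanishes_on_line)
  then obtain q where q: "f = L * q" ..
  have f_eval: "eval2 f x y = (b * x - a * y) * eval2 q x y" for x y
    by (simp add: q eval2_mult eval2_linear_form L_def)
  have "eval2 q (s * a) (s * b) = 0" for s
  proof -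
    have "((\<lambda>t. eval2 f t (s * b)) has_real_derivative b * eval2 q (s * a) (s * b)) (at (s * a))"
      unfolding f_eval
      by (rule derivative_eq_intros has_derivative_pd_x refl)+ (simp add: algebra_simps)
    then have bq: "b * eval2 q (s * a) (s * b) = 0"
      using has_derivative_pd_x fx_line DERIV_unique by metis
    have "((\<lambda>t. eval2 f (s * a) t) has_real_derivative - a * eval2 q (s * a) (s * b)) (at (s * b))"
      unfolding f_eval
      by (rule derivative_eq_intros has_derivative_pd_y refl)+ (simp add: algebra_simps)
    then have "- a * eval2 q (s * a) (s * b) = 0"
      using has_derivative_pd_y fy_line DERIV_unique by metis
    then show ?thesis
      using bq ab by auto
  qed
  then have "L dvd q"
    unfolding L_def using ab by (intro linear_form_dvd_if_vanishes_on_line)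
  then show ?thesis
    unfolding q power2_eq_square by (simp add: mult_dvd_mono flip: L_def)
qed


section \<open>Zeros of a form near a given direction\<close>

text \<open>
  On the line through \<open>(a, b)\<close> orthogonal to this vector, \<open>g\<close> is a nonzero polynomial in one
  variable, so near \<open>(a, b)\<close> its only possible root is \<open>(a, b)\<close> itself. Homogeneity carries
  this over to a neighbourhood in the plane.
\<close>

lemma zeros_near_direction:
  assumes "g \<noteq> 0" and ab: "(a, b) \<noteq> (0, 0)"
    and scaling: "\<And>s x y. eval2 g (s * x) (s * y) = s ^ m * eval2 g x y"
  shows "\<forall>\<^sub>F (x, y) in nhds (a, b). eval2 g x y = 0 \<longrightarrow> (\<exists>s>0. x = s * a \<and> y = s * b)"
proof -
  define N where "N = a\<^sup>2 + b\<^sup>2"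
  have N: "N > 0"
    using ab by (auto simp: N_def sum_power2_gt_zero_iff)
  obtain h where h: "\<And>t. poly h t = eval2 g (a + t * (- b)) (b + t * a)"
    using eval2_on_line[of g a "- b" b a] by blast
  \<comment> \<open>\<open>d x y / N\<close> is the coordinate of \<open>(x, y)\<close> along \<open>(a, b)\<close>, and \<open>\<tau> x y\<close> is the slope of \<open>(x, y)\<close> in the
      orthogonal basis \<open>(a, b)\<close>, \<open>(- b, a)\<close>.\<close>
  define d where "d x y = a * x + b * y" for x y
  define \<tau> where "\<tau> x y = (a * y - b * x) / d x y" for x y
  have coords: "d x y / N * (a + \<tau> x y * (- b)) = x" "d x y / N * (b + \<tau> x y * a) = y"
    if "d x y > 0" for x y
  proof -
    have d\<tau>: "d x y * \<tau> x y = a * y - b * x"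
      using that by (simp add: \<tau>_def)
    have "d x y * (a + \<tau> x y * (- b)) = d x y * a - (d x y * \<tau> x y) * b"
      by (simp add: algebra_simps)
    also have "\<dots> = N * x"
      unfolding d\<tau> by (simp add: d_def N_def power2_eq_square algebra_simps)
    finally have e1: "d x y * (a + \<tau> x y * (- b)) = N * x" .
    have "d x y * (b + \<tau> x y * a) = d x y * b + (d x y * \<tau> x y) * a"
      by (simp add: algebra_simps)
    also have "\<dots> = N * y"
      unfolding d\<tau> by (simp add: d_def N_def power2_eq_square algebra_simps)
    finally have e2: "d x y * (b + \<tau> x y * a) = N * y" .
    have "N \<noteq> 0"
      using N by simp
    then show "d x y / N * (a + \<tau> x y * (- b)) = x" "d x y / N * (b + \<tau> x y * a) = y"
      unfolding times_divide_eq_left e1 e2 by (rule nonzero_mult_div_cancel_left)+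
  qed
  have eval_h: "eval2 g x y = (d x y / N) ^ m * poly h (\<tau> x y)" if "d x y > 0" for x y
    by (simp only: h coords[OF that] flip: scaling)
  \<comment> \<open>If \<open>h\<close> vanished, so would \<open>g\<close> on the half plane \<open>d > 0\<close>. Every line parallel to \<open>(a, b)\<close> has a
      half-line in it, so \<open>g\<close> would vanish on all these lines.\<close>
  have "h \<noteq> 0"
  proof
    assume "h = 0"
    have "eval2 g x y = 0" for x y
    proof -
      obtain k where k: "\<And>s. poly k s = eval2 g (x + s * a) (y + s * b)"
        using eval2_on_line[of g x a y b] by blast
      have "poly k s = 0" if "s > - d x y / N" for s
      proof -
        have "d (x + s * a) (y + s * b) = d x y + s * N"
          by (simp add: d_def N_def power2_eq_square algebra_simps)
        moreover have "d x y + s * N > 0"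
          using that N by (simp add: field_simps)
        ultimately show ?thesis
          using eval_h[of "x + s * a" "y + s * b"] \<open>h = 0\<close> by (simp add: k)
      qed
      then have "{- d x y / N<..} \<subseteq> {s. poly k s = 0}"
        by auto
      then have "infinite {s. poly k s = 0}"
        using infinite_Ioi finite_subset by blast
      then have "k = 0"
        using poly_roots_finite by blast
      then show ?thesis
        using k[of 0] by simp
    qed
    then show False
      using eval2_eq_0_imp_eq_0 \<open>g \<noteq> 0\<close> by blast
  qed
  then have "finite ({t. poly h t = 0} - {0})"
    by (simp add: poly_roots_finite)
  then have "open (- ({t. poly h t = 0} - {0}))"
    by (rule open_Compl[OF finite_imp_closed])
  moreover have "0 \<in> - ({t. poly h t = 0} - {0})"
    by simp
  ultimately have "\<forall>\<^sub>F t in nhds 0. t \<in> - ({t. poly h t = 0} - {0})"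
    by (rule eventually_nhds_in_open)
  moreover have "((\<lambda>z. \<tau> (fst z) (snd z)) \<longlongrightarrow> 0) (nhds (a, b))"
  proof -
    have "a * fst (a, b) + b * snd (a, b) \<noteq> 0"
      using N by (auto simp: N_def power2_eq_square)
    then have "isCont (\<lambda>z. \<tau> (fst z) (snd z)) (a, b)"
      unfolding \<tau>_def d_def by (intro continuous_intros)
    moreover have "\<tau> a b = 0"
      by (simp add: \<tau>_def)
    ultimately show ?thesis
      using tendsto_at_iff_tendsto_nhds[of "\<lambda>z. \<tau> (fst z) (snd z)" "(a, b)"]
      by (simp add: isCont_def)
  qed
  ultimately have ev_\<tau>:
    "\<forall>\<^sub>F z in nhds (a, b). \<tau> (fst z) (snd z) \<in> - ({t. poly h t = 0} - {0})"
    by (rule eventually_compose_filterlim)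
  have "open {z. 0 < d (fst z) (snd z)}"
    unfolding d_def by (intro open_Collect_less continuous_intros)
  moreover have "(a, b) \<in> {z. 0 < d (fst z) (snd z)}"
    using N by (simp add: d_def N_def power2_eq_square)
  ultimately have "\<forall>\<^sub>F z in nhds (a, b). z \<in> {z. 0 < d (fst z) (snd z)}"
    by (rule eventually_nhds_in_open)
  with ev_\<tau> show ?thesis
  proof eventually_elim
    case (elim z)
    obtain x y where z: "z = (x, y)"
      by fastforce
    have d: "d x y > 0"
      using elim z by simp
    have "\<exists>s>0. x = s * a \<and> y = s * b" if "eval2 g x y = 0"
    proof -
      have "\<tau> x y = 0"
        using that eval_h[OF d] d N elim(1) z by simp
      then show ?thesis
        using coords[OF d] d N by (intro exI[of _ "d x y / N"]) simp
    qed
    then show ?case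
      by (simp add: z)
  qed
qed


section \<open>Flat points\<close>

definition angular_derivative :: "real poly poly \<Rightarrow> real poly poly" where
  "angular_derivative f = smult [:0, 1:] (pd_y f) - pCons 0 (pd_x f)"

lemma eval2_angular_derivative:
  "eval2 (angular_derivative f) x y = x * eval2 (pd_y f) x y - y * eval2 (pd_x f) x y"
  by (simp add: angular_derivative_def eval2_diff eval2_smult)

text \<open>
  The condition on the gradient is the form in which the absence of repeated real linear factors
  enters all computations below.
\<close>

locale nonsingular_form =
  fixes n :: nat and f :: "real poly poly"
  assumes n: "n \<ge> 2" and form_f: "form n f"
    and gradient: "\<And>u v. (u, v) \<noteq> (0, 0) \<Longrightarrow> eval2 (pd_x f) u v \<noteq> 0 \<or> eval2 (pd_y f) u v \<noteq> 0"
begin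

abbreviation "F \<equiv> eval2 f"
abbreviation "Fu \<equiv> eval2 (pd_x f)"
abbreviation "Fv \<equiv> eval2 (pd_y f)"
abbreviation "Fuu \<equiv> eval2 (pd_x (pd_x f))"
abbreviation "Fuv \<equiv> eval2 (pd_y (pd_x f))"
abbreviation "Fvv \<equiv> eval2 (pd_y (pd_y f))"
abbreviation "H \<equiv> eval2 (hess f)"
abbreviation "G \<equiv> eval2 (angular_derivative f)"

lemma Euler:
  shows "u * Fu u v + v * Fv u v = real n * F u v"
    and "u * Fuu u v + v * Fuv u v = real (n - 1) * Fu u v"
    and "u * Fuv u v + v * Fvv u v = real (n - 1) * Fv u v"
  using Euler_relation[OF form_f] Euler_relation[OF form_pd_x[OF form_f]]
    Euler_relation[OF form_pd_y[OF form_f]]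
  by (simp_all add: pd_x_pd_y)

text \<open>
  Euler's relations say that the Hessian matrix maps \<open>(u, v)\<close> to \<open>n - 1\<close> times the gradient, so
  eliminating the gradient leaves the determinant. These expressions are the factor of the
  principal directions form that remains at \<open>\<omega> = 0\<close> once the differential of \<open>f\<close> is split off.
\<close>

lemma Hessian_on_rotated_gradient:
  shows "real (n - 1) * (Fuv u v * Fu u v - Fuu u v * Fv u v) = - v * H u v"
    and "real (n - 1) * (Fvv u v * Fu u v - Fuv u v * Fv u v) = u * H u v"
proof -
  have "real (n - 1) * (Fuv u v * Fu u v - Fuu u v * Fv u v)
      = Fuv u v * (real (n - 1) * Fu u v) - Fuu u v * (real (n - 1) * Fv u v)"
    by (simp add: algebra_simps)
  also have "\<dots> = - v * H u v"
    unfolding Euler[symmetric] eval2_hess by (simp add: power2_eq_square algebra_simps)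
  finally show "real (n - 1) * (Fuv u v * Fu u v - Fuu u v * Fv u v) = - v * H u v" .
  have "real (n - 1) * (Fvv u v * Fu u v - Fuv u v * Fv u v)
      = Fvv u v * (real (n - 1) * Fu u v) - Fuv u v * (real (n - 1) * Fv u v)"
    by (simp add: algebra_simps)
  also have "\<dots> = u * H u v"
    unfolding Euler[symmetric] eval2_hess by (simp add: power2_eq_square algebra_simps)
  finally show "real (n - 1) * (Fvv u v * Fu u v - Fuv u v * Fv u v) = u * H u v" .
qed

lemma scaling_hess: "H (s * x) (s * y) = s ^ (2 * (n - 2)) * H x y"
proof -
  have "form (n - 2) (pd_x (pd_x f))" "form (n - 2) (pd_y (pd_x f))" "form (n - 2) (pd_y (pd_y f))"
    using form_pd_x[OF form_pd_x[OF form_f]] form_pd_y[OF form_pd_x[OF form_f]]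
      form_pd_y[OF form_pd_y[OF form_f]]
    by (simp_all add: numeral_2_eq_2)
  moreover have "s ^ (2 * (n - 2)) = s ^ (n - 2) * s ^ (n - 2)"
    by (simp only: mult_2 power_add)
  ultimately show ?thesis
    by (simp only: eval2_hess form_scaling power2_eq_square) (simp add: algebra_simps)
qed

lemma scaling_f_hess:
  "eval2 (f * hess f) (s * x) (s * y) = s ^ (n + 2 * (n - 2)) * eval2 (f * hess f) x y"
  by (simp add: eval2_mult scaling_hess form_scaling[OF form_f] power_add)

lemma scaling_angular_derivative: "G (s * x) (s * y) = s ^ n * G x y"
proof -
  have "s ^ n = s * s ^ (n - 1)"
    using n by (cases n) auto
  then show ?thesis
    by (simp add: eval2_angular_derivative form_scaling[OF form_pd_x[OF form_f]]
        form_scaling[OF form_pd_y[OF form_f]] algebra_simps)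
qed

text \<open>
  At \<open>\<omega> = 0\<close> the form \<open>A du\<^sup>2 + B du dv + C dv\<^sup>2\<close> is the product of \<open>f\<^sub>u du + f\<^sub>v dv\<close> and
  \<open>P du + Q dv\<close>, where \<open>(n - 1) (P, Q) = H (- v, u)\<close> by \<open>Hessian_on_rotated_gradient\<close>. The
  coefficients of \<open>du d\<omega>\<close> and \<open>dv d\<omega>\<close> are, up to sign, those of its polarization at \<open>(u, v)\<close>.
  There the second factor is zero and the first is \<open>n f\<close>, which leaves \<open>n f (P du + Q dv)\<close>.
\<close>

lemma flat_on_equator:
  assumes flat: "flat_point n f (u, v, 0)"
  shows "F u v * H u v = 0"
proof -
  define P where "P = Fuv u v * Fu u v - Fuu u v * Fv u v"
  define Q where "Q = Fvv u v * Fu u v - Fuv u v * Fv u v"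
  have PQ: "real (n - 1) * P = - v * H u v" "real (n - 1) * Q = u * H u v"
    unfolding P_def Q_def by (rule Hessian_on_rotated_gradient)+
  have W: "(0::real) ^ (2 * (n - 1)) = 0"
    using n by simp
  have A: "Phi_A n f (u, v, 0) = Fu u v * P"
    and B: "Phi_B n f (u, v, 0) = Fu u v * Q + Fv u v * P"
    and C: "Phi_C n f (u, v, 0) = Fv u v * Q"
    unfolding Phi_A_def Phi_B_def Phi_C_def P_def Q_def Let_def split W
    by (simp_all add: power2_eq_square algebra_simps)
  have "real (n - 1) * (2 * u * (Fu u v * P) + v * (Fu u v * Q + Fv u v * P))
      = 2 * u * Fu u v * (real (n - 1) * P) + v * (Fu u v * (real (n - 1) * Q) + Fv u v * (real (n - 1) * P))"
    by (simp add: algebra_simps)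
  also have "\<dots> = - v * H u v * (u * Fu u v + v * Fv u v)"
    unfolding PQ by (simp add: algebra_simps)
  finally have uA_vB: "real (n - 1) * (2 * u * (Fu u v * P) + v * (Fu u v * Q + Fv u v * P))
      = - v * H u v * (u * Fu u v + v * Fv u v)" .
  have "2 * u * (Fu u v * P) + v * (Fu u v * Q + Fv u v * P) = 0"
    using flat unfolding flat_point_def Phi_uw_def split A B by linarith
  then have 1: "v * H u v * (u * Fu u v + v * Fv u v) = 0"
    using uA_vB by simp
  have "real (n - 1) * (u * (Fu u v * Q + Fv u v * P) + 2 * v * (Fv u v * Q))
      = u * (Fu u v * (real (n - 1) * Q) + Fv u v * (real (n - 1) * P)) + 2 * v * Fv u v * (real (n - 1) * Q)"
    by (simp add: algebra_simps)
  also have "\<dots> = u * H u v * (u * Fu u v + v * Fv u v)"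
    unfolding PQ by (simp add: algebra_simps)
  finally have uB_vC: "real (n - 1) * (u * (Fu u v * Q + Fv u v * P) + 2 * v * (Fv u v * Q))
      = u * H u v * (u * Fu u v + v * Fv u v)" .
  have "u * (Fu u v * Q + Fv u v * P) + 2 * v * (Fv u v * Q) = 0"
    using flat unfolding flat_point_def Phi_vw_def split B C by linarith
  then have 2: "u * H u v * (u * Fu u v + v * Fv u v) = 0"
    using uB_vC by simp
  have "(u, v) \<noteq> (0, 0)"
    using flat by (auto simp: flat_point_def S2_def)
  then show ?thesis
    using 1 2 n by (auto simp: Euler)
qed

text \<open>
  If \<open>H u v = 0\<close>, the parts of \<open>A\<close> and \<open>B\<close> without \<open>\<omega>\<close> vanish, and the remaining ones say that the
  Hessian matrix is a multiple of the identity. Having determinant zero, it is zero, and by Euler's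
  relations so is the gradient.
\<close>

lemma flat_off_equator:
  assumes flat: "flat_point n f (u, v, w)" and w: "w \<noteq> 0" and uv: "(u, v) \<noteq> (0, 0)"
  shows "G u v = 0" "H u v \<noteq> 0"
proof -
  show "G u v = 0"
    using flat w n by (simp add: flat_point_def Phi_ww_def eval2_angular_derivative)
  show "H u v \<noteq> 0"
  proof
    assume H: "H u v = 0"
    define P where "P = Fuv u v * Fu u v - Fuu u v * Fv u v"
    define Q where "Q = Fvv u v * Fu u v - Fuv u v * Fv u v"
    have PQ: "P = 0" "Q = 0"
      using Hessian_on_rotated_gradient[of u v] H n by (simp_all add: P_def Q_def)
    have "Phi_A n f (u, v, w) = Fu u v * P + w ^ (2 * (n - 1)) * Fuv u v"
      "Phi_B n f (u, v, w) = Fu u v * Q + Fv u v * P + w ^ (2 * (n - 1)) * (Fvv u v - Fuu u v)"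
      unfolding Phi_A_def Phi_B_def P_def Q_def Let_def split
      by (simp_all add: power2_eq_square algebra_simps)
    moreover have "Phi_A n f (u, v, w) = 0" "Phi_B n f (u, v, w) = 0"
      using flat w by (simp_all add: flat_point_def Phi_uu_def Phi_uv_def)
    ultimately have "Fuv u v = 0" "Fvv u v = Fuu u v"
      using PQ w by simp_all
    moreover from this have "Fuu u v = 0"
      using H by (simp add: eval2_hess)
    ultimately have "Fu u v = 0" "Fv u v = 0"
      using Euler(2,3)[of u v] n by simp_all
    then show False
      using gradient uv by blast
  qed
qed

text \<open>
  If \<open>f\<close> and \<open>G\<close> both vanished at \<open>(u, v)\<close>, the gradient would be orthogonal to \<open>(- v, u)\<close> and, by
  Euler's relation, to \<open>(u, v)\<close>; so \<open>G = 0\<close> leaves only \<open>H = 0\<close>. If \<open>G\<close> vanished identically,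
  \<open>f\<close> would be constant on circles; then differentiating \<open>G\<close> expresses the gradient by the second
  derivatives in such a way that its squared norm is a combination of the two expressions in
  \<open>Hessian_on_rotated_gradient\<close>, which vanish with \<open>H\<close>.
\<close>

lemma angular_derivative_nonzero:
  assumes uv: "(u, v) \<noteq> (0, 0)" and FH: "F u v * H u v = 0"
  shows "G u v = 0 \<Longrightarrow> H u v = 0" and "angular_derivative f \<noteq> 0"
proof -
  have "F u v \<noteq> 0" if G: "G u v = 0"
  proof
    assume "F u v = 0"
    then have E: "u * Fu u v + v * Fv u v = 0"
      by (simp add: Euler)
    have G': "u * Fv u v - v * Fu u v = 0"
      using G by (simp add: eval2_angular_derivative)
    have "(u\<^sup>2 + v\<^sup>2) * Fu u v = u * (u * Fu u v + v * Fv u v) - v * (u * Fv u v - v * Fu u v)"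
      "(u\<^sup>2 + v\<^sup>2) * Fv u v = v * (u * Fu u v + v * Fv u v) + u * (u * Fv u v - v * Fu u v)"
      by (simp_all add: power2_eq_square algebra_simps)
    then have "(u\<^sup>2 + v\<^sup>2) * Fu u v = 0" "(u\<^sup>2 + v\<^sup>2) * Fv u v = 0"
      by (simp_all only: E G' mult_zero_right diff_self add_0)
    then show False
      using gradient[OF uv] uv by (auto simp: sum_power2_eq_zero_iff)
  qed
  then show H: "H u v = 0" if "G u v = 0"
    using that FH by simp
  show "angular_derivative f \<noteq> 0"
  proof
    assume "angular_derivative f = 0"
    then have G: "eval2 (angular_derivative f) x y = 0" for x y
      by simp
    then have G0: "x * Fv x y - y * Fu x y = 0" for x y
      by (simp add: eval2_angular_derivative)
    have "((\<lambda>t. t * Fv t v - v * Fu t v) has_real_derivative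
        Fv u v + u * Fuv u v - v * Fuu u v) (at u)"
      by (rule derivative_eq_intros has_derivative_pd_x refl)+ (simp add: pd_x_pd_y)
    then have Gu: "Fv u v + u * Fuv u v - v * Fuu u v = 0"
      unfolding G0 using DERIV_const DERIV_unique by blast
    have "((\<lambda>t. u * Fv u t - t * Fu u t) has_real_derivative
        u * Fvv u v - Fu u v - v * Fuv u v) (at v)"
      by (rule derivative_eq_intros has_derivative_pd_y refl)+ simp
    then have Gv: "u * Fvv u v - Fu u v - v * Fuv u v = 0"
      unfolding G0 using DERIV_const DERIV_unique by blast
    have P: "Fuv u v * Fu u v = Fuu u v * Fv u v" and Q: "Fvv u v * Fu u v = Fuv u v * Fv u v"
      using Hessian_on_rotated_gradient[of u v] H[OF G] n by simp_all
    have gradient_eq: "Fu u v = u * Fvv u v - v * Fuv u v" "Fv u v = v * Fuu u v - u * Fuv u v"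
      using Gu Gv by linarith+
    have "(Fu u v)\<^sup>2 + (Fv u v)\<^sup>2
        = Fu u v * (u * Fvv u v - v * Fuv u v) + Fv u v * (v * Fuu u v - u * Fuv u v)"
      by (simp only: power2_eq_square flip: gradient_eq)
    also have "\<dots> = u * (Fvv u v * Fu u v - Fuv u v * Fv u v) - v * (Fuv u v * Fu u v - Fuu u v * Fv u v)"
      by (simp add: algebra_simps)
    also have "\<dots> = 0"
      by (simp add: P Q)
    finally have "(Fu u v)\<^sup>2 + (Fv u v)\<^sup>2 = 0" .
    then show False
      using gradient[OF uv] by (simp add: sum_power2_eq_zero_iff)
  qed
qed

lemma flat_on_equator_isolated:
  assumes hess: "hess f \<noteq> 0" and p: "flat_point n f (a, b, 0)"
  shows "(a, b, 0) isolated_in {q. flat_point n f q}"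
proof -
  have ab1: "a\<^sup>2 + b\<^sup>2 = 1"
    using p by (simp add: flat_point_def S2_def)
  then have ab: "(a, b) \<noteq> (0, 0)"
    by auto
  have FH: "F a b * H a b = 0"
    using flat_on_equator[OF p] .
  have "f \<noteq> 0"
    using gradient[OF ab] by (auto simp: pd_y_def)
  then have fH: "f * hess f \<noteq> 0"
    using hess by simp
  have "\<forall>\<^sub>F (x, y) in nhds (a, b). G x y = 0 \<longrightarrow> (\<exists>s>0. x = s * a \<and> y = s * b)"
    using angular_derivative_nonzero(2)[OF ab FH] ab scaling_angular_derivative
    by (rule zeros_near_direction)
  moreover have "\<forall>\<^sub>F (x, y) in nhds (a, b). eval2 (f * hess f) x y = 0 \<longrightarrow> (\<exists>s>0. x = s * a \<and> y = s * b)"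
    using fH ab scaling_f_hess by (rule zeros_near_direction)
  moreover have "\<forall>\<^sub>F z in nhds (a, b). z \<in> - {(0, 0)}"
    using ab by (intro eventually_nhds_in_open) auto
  ultimately have "\<forall>\<^sub>F (x, y) in nhds (a, b). (x, y) \<noteq> (0, 0) \<and>
      (G x y = 0 \<or> F x y * H x y = 0 \<longrightarrow> (\<exists>s>0. x = s * a \<and> y = s * b))"
  proof eventually_elim
    case (elim z)
    then show ?case
      by (cases z) (simp add: eval2_mult)
  qed
  then obtain T where T: "open T" "(a, b) \<in> T" and T_all: "\<forall>(x, y)\<in>T. (x, y) \<noteq> (0, 0) \<and>
      (G x y = 0 \<or> F x y * H x y = 0 \<longrightarrow> (\<exists>s>0. x = s * a \<and> y = s * b))"
    unfolding eventually_nhds by blast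
  have T_nz: "(x, y) \<noteq> (0, 0)" if "(x, y) \<in> T" for x y
    using bspec[OF T_all that] by simp
  have T_line: "\<exists>s>0. x = s * a \<and> y = s * b"
    if "(x, y) \<in> T" "G x y = 0 \<or> F x y * H x y = 0" for x y
    by (rule bspec[OF T_all that(1), unfolded split, THEN conjunct2, THEN mp, OF that(2)])
  define U :: "(real \<times> real \<times> real) set" where "U = {(x, y, w). (x, y) \<in> T}"
  have "U = (\<lambda>q. (fst q, fst (snd q))) -` T"
    by (auto simp: U_def)
  then have "open U"
    using T(1) by (auto intro!: open_vimage continuous_intros)
  moreover have "U \<inter> {q. flat_point n f q} = {(a, b, 0)}"
  proof (intro equalityI subsetI)
    fix q assume q: "q \<in> U \<inter> {q. flat_point n f q}"
    obtain x y w where xyw: "q = (x, y, w)"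
      by (cases q) auto
    have flat: "flat_point n f (x, y, w)" and xy: "(x, y) \<in> T"
      using q by (auto simp: xyw U_def)
    \<comment> \<open>Off the equator, \<open>(x, y)\<close> is on the ray through \<open>(a, b)\<close>, so that \<open>H\<close> vanishes at both or at
        neither.\<close>
    have w: "w = 0"
    proof (rule ccontr)
      assume "w \<noteq> 0"
      note off = flat_off_equator[OF flat this T_nz[OF xy]]
      from T_line[OF xy disjI1[OF off(1)]] obtain s where s: "s > 0" "x = s * a" "y = s * b"
        by (elim exE conjE)
      have "G a b = 0"
        using off(1) s by (simp add: scaling_angular_derivative)
      then have "H a b = 0"
        by (rule angular_derivative_nonzero(1)[OF ab FH])
      then show False
        using off(2) s by (simp add: scaling_hess)
    qed
    then have "F x y * H x y = 0"
      using flat_on_equator flat by simp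
    from T_line[OF xy disjI2[OF this]] obtain s where s: "s > 0" "x = s * a" "y = s * b"
      by (elim exE conjE)
    have "(s * a)\<^sup>2 + (s * b)\<^sup>2 = 1"
      using flat s w by (simp add: flat_point_def S2_def)
    then have "s\<^sup>2 * (a\<^sup>2 + b\<^sup>2) = 1"
      by (simp only: power_mult_distrib distrib_left)
    then have "s = 1"
      using ab1 s(1) by (simp add: power2_eq_1_iff)
    then show "q \<in> {(a, b, 0)}"
      using s w xyw by simp
  next
    fix q :: "real \<times> real \<times> real" assume "q \<in> {(a, b, 0)}"
    then show "q \<in> U \<inter> {q. flat_point n f q}"
      using T(2) p by (simp add: U_def)
  qed
  ultimately show ?thesis
    using p unfolding isolated_in_def by blast
qed

end

theorem theorem4p12:
  fixes n :: nat and f :: "real poly poly" and p :: "real \<times> real \<times> real"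
  assumes "n \<ge> 2"
    and "homogeneous n f"
    and "no_repeated_linear_factor f"
    and "no_repeated_linear_factor (hess f)"
    and "p \<in> S2"
  shows "umbilic_at_infinity n f p \<longleftrightarrow> flat_point n f p \<and> p \<in> equator"
proof
  assume "umbilic_at_infinity n f p"
  then show "flat_point n f p \<and> p \<in> equator"
    by (auto simp: umbilic_at_infinity_def isolated_in_def)
next
  assume p: "flat_point n f p \<and> p \<in> equator"
  then obtain a b where ab: "p = (a, b, 0)"
    by (auto simp: equator_def)
  have form: "form n f"
    using assms(2) by (simp add: homogeneous_def form_def)
  interpret nonsingular_form n f
  proof
    fix u v :: real
    assume uv: "(u, v) \<noteq> (0, 0)"
    show "eval2 (pd_x f) u v \<noteq> 0 \<or> eval2 (pd_y f) u v \<noteq> 0"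
    proof (rule ccontr)
      assume "\<not> ?thesis"
      then have "(linear_form v (- u))\<^sup>2 dvd f"
        using repeated_factor_if_singular[OF form uv] assms(1) by simp
      moreover have "(v, - u) \<noteq> (0, 0)"
        using uv by auto
      ultimately show False
        using assms(3) unfolding no_repeated_linear_factor_def by blast
    qed
  qed (use assms(1) form in simp_all)
  have "hess f \<noteq> 0"
  proof
    assume "hess f = 0"
    then have "(linear_form 1 0)\<^sup>2 dvd hess f"
      by simp
    moreover have "(1, 0) \<noteq> (0 :: real, 0 :: real)"
      by simp
    ultimately show False
      using assms(4) unfolding no_repeated_linear_factor_def by blast
  qed
  then have "p isolated_in {q. flat_point n f q}"
    using p flat_on_equator_isolated unfolding ab by blast
  then show "umbilic_at_infinity n f p"
    using p unfolding umbilic_at_infinity_def by blast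
qed

end
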